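(* Let $T$ be a finite rooted tree with root $\rho$ in which every leaf is at distance $m\ge 1$ from $\rho$, and let $(T,\Psi)$ be a Markov random field on $T$: each vertex $v$ has a finite domain $D_v$, each edge $e=(u,v)$ has a potential $\Psi_e:D_u\times D_v\to\mathbb{R}_{\ge 0}$, and $$\mathbb{P}_T(\bar\sigma)=\frac{1}{Z_T}\prod_{e=(u,v)\in E(T)}\Psi_e(\sigma_u,\sigma_v),\qquad \bar\sigma\in\prod_{v}D_v,$$ with $Z_T>0$ the normalizing constant. Let $v_1,\dots,v_r$ be the children of $\rho$, $e_i=(\rho,v_i)$, and $T_i$ the subtree rooted at $v_i$ (with the induced Markov random field). Define $f:\mathcal{P}_{v_1}\times\cdots\times\mathcal{P}_{v_r}\to\mathbb{R}^{D_\rho}$, where $\mathcal{P}_v$ is the set of probability vectors on $D_v$, by $$f^a(\eta_1,\dots,\eta_r)=\prod_{i=1}^r\sum_{s\in D_{v_i}}\eta_i^{s}\,\Psi_{e_i}(a,s),\qquad a\in D_\rho,$$ and $\|f(\eta_1,\dots,\eta_r)\|=\sum_{a\in D_\rho}f^a(\eta_1,\dots,\eta_r)$. Let $\mathbf{P_1},\dots,\mathbf{P_r}$ be independent random vectors with $\mathbf{P_i}$ distributed according to the residual distribution at the root of $T_i$, and let $\mathbf{Q}$ be distributed according to the residual distribution at the root of $T$. Then there is a constant $c>0$ not depending on $\eta$ such that for every $\eta\in\mathcal{P}_\rho$, $$\mathbb{P}(\mathbf{Q}=\eta)=c\cdot\mathbb{E}\big[\|f(\mathbf{P_1},\dots,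\mathbf{P_r})\|\cdot\mathbf{1}[f(\mathbf{P_1},\dots,\mathbf{P_r})\propto\eta]\big].$$
   Context: The residual distribution at the root of a tree Markov random field $(T,\Psi)$ whose leaves are all at distance $m$ from the root is the distribution of the probability vector $\eta=(\mathbb{P}_T(\sigma_\rho=a\mid \bar\sigma(m)=L))_{a\in D_\rho}$, where $\bar\sigma(m)$ denotes the configuration on the vertices at distance $m$ from the root and the boundary configuration $L$ is drawn according to $\mathbb{P}_T$. For vectors $x,y$, $x\propto y$ means $x$ and $y$ are equal up to a (positive) multiplicative constant. *)

theory Defs
  imports "HOL-Probability.Probability" "Graph_Theory.Graph_Theory"
begin

text \<open>
  Arcs point away from the root. The predicate \<open>tree\<close> of Graph Theory is not used:
  it has no root and excludes directed cycles only, so it also admits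
  differently oriented graphs with an undirected cycle.
\<close>

locale rooted_tree = fin_digraph T for T :: "('v, 'e) pre_digraph" +
  fixes \<rho> :: 'v
  assumes root_in_verts: "\<rho> \<in> verts T"
    and unique_awalk: "v \<in> verts T \<Longrightarrow> \<exists>!p. awalk \<rho> p v"

definition level :: "('v, 'e) pre_digraph \<Rightarrow> 'v \<Rightarrow> nat \<Rightarrow> 'v set" where
  "level T \<rho> m = {v \<in> verts T. \<exists>p. pre_digraph.awalk T \<rho> p v \<and> length p = m}"

definition leaves :: "('v, 'e) pre_digraph \<Rightarrow> 'v set" where
  "leaves T = {v \<in> verts T. out_arcs T v = {}}"

definition subtree :: "('v, 'e) pre_digraph \<Rightarrow> 'v \<Rightarrow> ('v, 'e) pre_digraph" where
  "subtree T v = T \<restriction> {w. v \<rightarrow>\<^sup>*\<^bsub>T\<^esub> w}"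

text \<open>
  All vertex domains are subsets of one type of spins. The potential of an arc takes the
  spin of its tail first. The same \<open>D\<close> and \<open>\<Psi>\<close> used with a subgraph give the induced field.
\<close>

definition configs :: "('v, 'e) pre_digraph \<Rightarrow> ('v \<Rightarrow> 's set) \<Rightarrow> ('v \<Rightarrow> 's) set" where
  "configs T D = (\<Pi>\<^sub>E v\<in>verts T. D v)"

definition weight ::
    "('v, 'e) pre_digraph \<Rightarrow> ('e \<Rightarrow> 's \<Rightarrow> 's \<Rightarrow> real) \<Rightarrow> ('v \<Rightarrow> 's) \<Rightarrow> real" where
  "weight T \<Psi> \<sigma> = (\<Prod>e\<in>arcs T. \<Psi> e (\<sigma> (tail T e)) (\<sigma> (head T e)))"

definition partition_fun ::
    "('v, 'e) pre_digraph \<Rightarrow> ('v \<Rightarrow> 's set) \<Rightarrow> ('e \<Rightarrow> 's \<Rightarrow> 's \<Rightarrow> real) \<Rightarrow> real" where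
  "partition_fun T D \<Psi> = (\<Sum>\<sigma>\<in>configs T D. weight T \<Psi> \<sigma>)"

locale mrf = fin_digraph T for T :: "('v, 'e) pre_digraph" +
  fixes D :: "'v \<Rightarrow> 's set" and \<Psi> :: "'e \<Rightarrow> 's \<Rightarrow> 's \<Rightarrow> real"
  assumes finite_domain: "v \<in> verts T \<Longrightarrow> finite (D v)"
    and potential_nonneg:
      "\<lbrakk>e \<in> arcs T; a \<in> D (tail T e); b \<in> D (head T e)\<rbrakk> \<Longrightarrow> 0 \<le> \<Psi> e a b"
    and partition_fun_pos: "0 < partition_fun T D \<Psi>"

definition gibbs ::
    "('v, 'e) pre_digraph \<Rightarrow> ('v \<Rightarrow> 's set) \<Rightarrow> ('e \<Rightarrow> 's \<Rightarrow> 's \<Rightarrow> real) \<Rightarrow> ('v \<Rightarrow> 's) pmf" where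
  "gibbs T D \<Psi> =
     embed_pmf (\<lambda>\<sigma>. if \<sigma> \<in> configs T D then weight T \<Psi> \<sigma> / partition_fun T D \<Psi> else 0)"

lemma (in mrf) finite_configs: "finite (configs T D)"
  unfolding configs_def by (intro finite_PiE finite_verts finite_domain)

lemma (in mrf) weight_nonneg:
  assumes "\<sigma> \<in> configs T D"
  shows "0 \<le> weight T \<Psi> \<sigma>"
  unfolding weight_def
proof (rule prod_nonneg)
  fix e assume e: "e \<in> arcs T"
  have "\<sigma> (tail T e) \<in> D (tail T e)" "\<sigma> (head T e) \<in> D (head T e)"
    using assms tail_in_verts[OF e] head_in_verts[OF e] unfolding configs_def by (blast intro: PiE_mem)+
  then show "0 \<le> \<Psi> e (\<sigma> (tail T e)) (\<sigma> (head T e))"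
    by (rule potential_nonneg[OF e])
qed

lemma (in mrf) pmf_gibbs:
  "pmf (gibbs T D \<Psi>) \<sigma> =
     (if \<sigma> \<in> configs T D then weight T \<Psi> \<sigma> / partition_fun T D \<Psi> else 0)"
  unfolding gibbs_def
proof (rule pmf_embed_pmf)
  let ?Z = "partition_fun T D \<Psi>"
  let ?g = "\<lambda>\<sigma>. if \<sigma> \<in> configs T D then weight T \<Psi> \<sigma> / ?Z else 0"
  show nonneg: "0 \<le> ?g \<tau>" for \<tau>
    using weight_nonneg[of \<tau>] partition_fun_pos by simp
  have "(\<Sum>\<tau>\<in>configs T D. ?g \<tau>) = (\<Sum>\<tau>\<in>configs T D. weight T \<Psi> \<tau> / ?Z)"
    by (rule sum.cong) simp_all
  also have "\<dots> = (\<Sum>\<tau>\<in>configs T D. weight T \<Psi> \<tau>) / ?Z"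
    by (rule sum_divide_distrib[symmetric])
  also have "\<dots> = ?Z / ?Z"
    by (simp only: partition_fun_def)
  also have "\<dots> = 1"
    using partition_fun_pos by simp
  finally have total: "(\<Sum>\<tau>\<in>configs T D. ?g \<tau>) = 1" .
  have "(\<integral>\<^sup>+\<tau>. ennreal (?g \<tau>) \<partial>count_space UNIV) = (\<Sum>\<tau>\<in>configs T D. ennreal (?g \<tau>))"
    by (rule nn_integral_count_space'[OF finite_configs]) simp_all
  also have "\<dots> = ennreal (\<Sum>\<tau>\<in>configs T D. ?g \<tau>)"
    by (rule sum_ennreal) (rule nonneg)
  finally show "(\<integral>\<^sup>+\<tau>. ennreal (?g \<tau>) \<partial>count_space UNIV) = 1"
    unfolding total by simp
qed

text \<open>Vectors indexed by \<open>A\<close> are extensional functions, so that equality is componentwise.\<close>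

abbreviation vec_borel :: "'s set \<Rightarrow> ('s \<Rightarrow> real) measure" where
  "vec_borel A \<equiv> PiM A (\<lambda>_. borel)"

definition prob_vectors :: "'s set \<Rightarrow> ('s \<Rightarrow> real) set" where
  "prob_vectors A = {\<eta> \<in> A \<rightarrow>\<^sub>E {0..}. (\<Sum>a\<in>A. \<eta> a) = 1}"

definition proportional_on :: "'s set \<Rightarrow> ('s \<Rightarrow> real) \<Rightarrow> ('s \<Rightarrow> real) \<Rightarrow> bool" where
  "proportional_on A x y \<longleftrightarrow> (\<exists>k>0. \<forall>a\<in>A. x a = k * y a)"

definition root_posterior ::
    "('v, 'e) pre_digraph \<Rightarrow> 'v \<Rightarrow> ('v \<Rightarrow> 's set) \<Rightarrow> ('e \<Rightarrow> 's \<Rightarrow> 's \<Rightarrow> real) \<Rightarrow> nat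
      \<Rightarrow> ('v \<Rightarrow> 's) \<Rightarrow> 's \<Rightarrow> real" where
  "root_posterior T \<rho> D \<Psi> m L =
     (\<lambda>a\<in>D \<rho>. \<P>(\<sigma> in measure_pmf (gibbs T D \<Psi>). \<sigma> \<rho> = a \<bar> restrict \<sigma> (level T \<rho> m) = L))"

definition residual_dist ::
    "('v, 'e) pre_digraph \<Rightarrow> 'v \<Rightarrow> ('v \<Rightarrow> 's set) \<Rightarrow> ('e \<Rightarrow> 's \<Rightarrow> 's \<Rightarrow> real) \<Rightarrow> nat
      \<Rightarrow> ('s \<Rightarrow> real) measure" where
  "residual_dist T \<rho> D \<Psi> m =
     distr (measure_pmf (gibbs T D \<Psi>)) (vec_borel (D \<rho>))
       (\<lambda>\<tau>. root_posterior T \<rho> D \<Psi> m (restrict \<tau> (level T \<rho> m)))"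

text \<open>
  A child of \<open>\<rho>\<close> is indexed by the arc \<open>e\<close> leading to it; the child is \<open>head T e\<close>.
\<close>

definition bp_map ::
    "('v, 'e) pre_digraph \<Rightarrow> 'v \<Rightarrow> ('v \<Rightarrow> 's set) \<Rightarrow> ('e \<Rightarrow> 's \<Rightarrow> 's \<Rightarrow> real)
      \<Rightarrow> ('e \<Rightarrow> 's \<Rightarrow> real) \<Rightarrow> 's \<Rightarrow> real" where
  "bp_map T \<rho> D \<Psi> \<eta> =
     (\<lambda>a\<in>D \<rho>. \<Prod>e\<in>out_arcs T \<rho>. \<Sum>s\<in>D (head T e). \<eta> e s * \<Psi> e a s)"

definition total_mass :: "'s set \<Rightarrow> ('s \<Rightarrow> real) \<Rightarrow> real" where
  "total_mass A x = (\<Sum>a\<in>A. x a)"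

end

theory Submission
  imports Defs
begin

text \<open>
  Fix a boundary condition \<open>L\<close> at level \<open>m\<close> and let \<open>W\<^sup>a(L)\<close> be the total weight of the
  configurations that extend \<open>L\<close> and have spin \<open>a\<close> at the root. The tree without its root is the
  disjoint union of the subtrees at the children, so with \<open>L\<^sub>i\<close> the part of \<open>L\<close> in the subtree
  \<open>T\<^sub>i\<close>, and \<open>W\<^sub>i\<close> and \<open>\<eta>\<^sub>i\<close> its boundary weight and posterior,
  \<open>W\<^sup>a(L) = (\<Prod>\<^sub>i W\<^sub>i(L\<^sub>i)) f\<^sup>a(\<eta>\<^sub>1, \<dots>, \<eta>\<^sub>r)\<close>. Hence the posterior given \<open>L\<close> is \<open>\<eta>\<close> exactly when
  \<open>f \<propto> \<eta>\<close>, and the probability \<open>W(L) / Z\<close> of \<open>L\<close> is \<open>\<parallel>f\<parallel>\<close> times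
  \<open>\<Prod>\<^sub>i W\<^sub>i(L\<^sub>i) / Z\<^sub>i\<close>, its probability under independent fields on the subtrees, times the constant
  \<open>c = (\<Prod>\<^sub>i Z\<^sub>i) / Z\<close>. Summing over \<open>L\<close> gives the claim.
\<close>

section \<open>Product laws and sums over disjoint index blocks\<close>

text \<open>By independence the joint law is the product of the marginals, and each marginal is the
  image of \<open>p i\<close> under \<open>f i\<close>. So the joint law is the image of the product
  of the \<open>p i\<close>, and the expectation becomes a finite sum. Each \<open>C i\<close> is
  only a finite superset of the support, so terms of mass 0 may occur.\<close>

lemma (in prob_space) expectation_indep_vars_finite_support:
  fixes G :: "('i \<Rightarrow> 'b) \<Rightarrow> real" and p :: "'i \<Rightarrow> 'c pmf"
  assumes I: "finite I" and ind: "indep_vars N X I"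
    and distr_X: "\<And>i. i \<in> I \<Longrightarrow> distr M (N i) (X i) = distr (measure_pmf (p i)) (N i) (f i)"
    and f: "\<And>i. i \<in> I \<Longrightarrow> f i \<in> measurable (count_space UNIV) (N i)"
    and C: "\<And>i. i \<in> I \<Longrightarrow> finite (C i)" "\<And>i. i \<in> I \<Longrightarrow> set_pmf (p i) \<subseteq> C i"
    and G: "G \<in> borel_measurable (PiM I N)"
  shows "expectation (\<lambda>\<omega>. G (\<lambda>i\<in>I. X i \<omega>))
    = (\<Sum>y\<in>PiE I C. (\<Prod>i\<in>I. pmf (p i) (y i)) * G (\<lambda>i\<in>I. f i (y i)))"
proof -
  \<comment> \<open>With default value \<open>undefined\<close> the sample points are extensional on
    \<open>I\<close>, so the support lies in \<open>PiE I C\<close>.\<close>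
  let ?J = "Pi_pmf I undefined p"
  have X: "i \<in> I \<Longrightarrow> random_variable (N i) (X i)" for i
    using ind by (simp add: indep_vars_def)
  have fJ: "i \<in> I \<Longrightarrow> (\<lambda>y. f i (y i)) \<in> measurable (measure_pmf ?J) (N i)" for i
    using measurable_space[OF f] by auto
  have joint: "distr M (PiM I N) (\<lambda>\<omega>. \<lambda>i\<in>I. X i \<omega>)
      = distr (measure_pmf ?J) (PiM I N) (\<lambda>y. \<lambda>i\<in>I. f i (y i))"
  proof (cases "I = {}")
    \<comment> \<open>Independence is equivalent to a product law only for a nonempty index set.
      Over the empty one both laws are the point mass at the function that is
      \<open>undefined\<close> everywhere.\<close>
    case True
    have const: "(\<lambda>\<omega>. \<lambda>i\<in>{}. Y i \<omega>) = (\<lambda>_ _. undefined)" for Y :: "'i \<Rightarrow> 'z \<Rightarrow> 'b"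
      by (auto simp: fun_eq_iff)
    show ?thesis
      unfolding True const
      by (intro measure_eqI)
        (auto simp: emeasure_distr space_PiM sets_PiM_empty emeasure_space_1 measure_pmf.emeasure_space_1)
  next
    case False
    have "prob_space.indep_vars (measure_pmf ?J) N (\<lambda>i y. f i (y i)) I"
      by (rule prob_space.indep_vars_compose2[OF measure_pmf.prob_space_axioms indep_vars_Pi_pmf[OF I] f])
    then have "distr (measure_pmf ?J) (PiM I N) (\<lambda>y. \<lambda>i\<in>I. f i (y i))
        = PiM I (\<lambda>i. distr (measure_pmf ?J) (N i) (\<lambda>y. f i (y i)))"
      using prob_space.indep_vars_iff_distr_eq_PiM'[OF measure_pmf.prob_space_axioms False fJ] by simp
    also have "\<dots> = PiM I (\<lambda>i. distr M (N i) (X i))"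
    proof (rule PiM_cong[OF refl])
      fix i assume i: "i \<in> I"
      have "distr (measure_pmf ?J) (N i) (\<lambda>y. f i (y i))
          = distr (distr (measure_pmf ?J) (count_space UNIV) (\<lambda>y. y i)) (N i) (f i)"
        by (subst distr_distr[OF f[OF i]]) (auto simp: comp_def)
      also have "\<dots> = distr (measure_pmf (map_pmf (\<lambda>y. y i) ?J)) (N i) (f i)"
        by (simp add: map_pmf_rep_eq)
      also have "\<dots> = distr M (N i) (X i)"
        using i I by (simp add: Pi_pmf_component distr_X)
      finally show "distr (measure_pmf ?J) (N i) (\<lambda>y. f i (y i)) = distr M (N i) (X i)" .
    qed
    also have "\<dots> = distr M (PiM I N) (\<lambda>\<omega>. \<lambda>i\<in>I. X i \<omega>)"
      using indep_vars_iff_distr_eq_PiM'[OF False X] ind by simp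
    finally show ?thesis by simp
  qed
  have "expectation (\<lambda>\<omega>. G (\<lambda>i\<in>I. X i \<omega>)) = integral\<^sup>L (distr M (PiM I N) (\<lambda>\<omega>. \<lambda>i\<in>I. X i \<omega>)) G"
    using X by (intro integral_distr[symmetric] measurable_restrict G) auto
  also have "\<dots> = measure_pmf.expectation ?J (\<lambda>y. G (\<lambda>i\<in>I. f i (y i)))"
    unfolding joint using fJ by (intro integral_distr measurable_restrict G) auto
  also have "\<dots> = (\<Sum>y\<in>PiE I C. pmf ?J y * G (\<lambda>i\<in>I. f i (y i)))"
    using C I
    by (subst integral_measure_pmf[of "PiE I C"])
      (auto intro!: finite_PiE simp: set_Pi_pmf PiE_dflt_def PiE_iff extensional_def)
  also have "\<dots> = (\<Sum>y\<in>PiE I C. (\<Prod>i\<in>I. pmf (p i) (y i)) * G (\<lambda>i\<in>I. f i (y i)))"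
    using I by (intro sum.cong refl) (auto simp: pmf_Pi PiE_iff extensional_def)
  finally show ?thesis .
qed

text \<open>Functions on disjoint blocks glue uniquely. This is applied to the levels of the
  subtrees (boundary conditions) and, through the next lemma, to their vertex sets
  (configurations).\<close>

lemma bij_betw_restrict_PiE_Union:
  fixes V :: "'i \<Rightarrow> 'a set" and D :: "'a \<Rightarrow> 'b set"
  assumes "disjoint_family_on V I"
  shows "bij_betw (\<lambda>g. \<lambda>i\<in>I. restrict g (V i)) (PiE (\<Union>i\<in>I. V i) D) (PiE I (\<lambda>i. PiE (V i) D))"
proof -
  \<comment> \<open>The inverse map: the value at \<open>x\<close> comes from the only block that
    contains \<open>x\<close>.\<close>
  define glue where "glue t = (\<lambda>x\<in>\<Union>i\<in>I. V i. t (THE i. i \<in> I \<and> x \<in> V i) x)" for t :: "'i \<Rightarrow> 'a \<Rightarrow> 'b"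
  have the: "(THE j. j \<in> I \<and> x \<in> V j) = i" if "i \<in> I" "x \<in> V i" for i x
    using that assms by (intro the_equality) (auto simp: disjoint_family_on_def)
  have glue: "glue t x = t i x" if "i \<in> I" "x \<in> V i" for t i x
    using that by (auto simp: glue_def the)
  show ?thesis
  proof (rule bij_betwI[where g = glue])
    show "(\<lambda>g. \<lambda>i\<in>I. restrict g (V i)) \<in> PiE (\<Union>i\<in>I. V i) D \<rightarrow> PiE I (\<lambda>i. PiE (V i) D)"
      by (auto simp: PiE_iff)
    show "glue \<in> PiE I (\<lambda>i. PiE (V i) D) \<rightarrow> PiE (\<Union>i\<in>I. V i) D"
    proof
      fix t assume t: "t \<in> PiE I (\<lambda>i. PiE (V i) D)"
      show "glue t \<in> PiE (\<Union>i\<in>I. V i) D"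
      proof (rule PiE_I)
        show "glue t x \<in> D x" if "x \<in> (\<Union>i\<in>I. V i)" for x
          using that t by (auto simp: glue PiE_iff)
      qed (simp add: glue_def)
    qed
    show "glue (\<lambda>i\<in>I. restrict g (V i)) = g" if g: "g \<in> PiE (\<Union>i\<in>I. V i) D" for g
    proof
      fix x
      show "glue (\<lambda>i\<in>I. restrict g (V i)) x = g x"
      proof (cases "x \<in> (\<Union>i\<in>I. V i)")
        case True
        then show ?thesis by (auto simp: glue)
      next
        case False
        then show ?thesis using PiE_arb[OF g False] by (simp add: glue_def)
      qed
    qed
    show "(\<lambda>i\<in>I. restrict (glue t) (V i)) = t" if t: "t \<in> PiE I (\<lambda>i. PiE (V i) D)" for t
    proof
      fix i
      show "(\<lambda>i\<in>I. restrict (glue t) (V i)) i = t i"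
      proof (cases "i \<in> I")
        case True
        then have "t i \<in> extensional (V i)" using t by (auto simp: PiE_iff)
        then show ?thesis using True by (auto simp: glue restrict_def extensional_def)
      next
        case False
        then show ?thesis using PiE_arb[OF t False] by simp
      qed
    qed
  qed
qed

text \<open>Distributivity turns the product of sums into a sum over families, and gluing turns
  families into functions on the union.\<close>

lemma sum_PiE_Union:
  fixes F :: "'i \<Rightarrow> ('v \<Rightarrow> 's) \<Rightarrow> 'c :: comm_semiring_1"
  assumes "disjoint_family_on V I" "finite I" "\<And>i. i \<in> I \<Longrightarrow> finite (PiE (V i) D)"
  shows "(\<Sum>g\<in>PiE (\<Union>i\<in>I. V i) D. \<Prod>i\<in>I. F i (restrict g (V i))) = (\<Prod>i\<in>I. \<Sum>t\<in>PiE (V i) D. F i t)"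
proof -
  have "(\<Prod>i\<in>I. \<Sum>t\<in>PiE (V i) D. F i t) = (\<Sum>t\<in>PiE I (\<lambda>i. PiE (V i) D). \<Prod>i\<in>I. F i (t i))"
    using assms(2,3) by (rule prod_sum_PiE)
  also have "\<dots> = (\<Sum>g\<in>PiE (\<Union>i\<in>I. V i) D. \<Prod>i\<in>I. F i ((\<lambda>i\<in>I. restrict g (V i)) i))"
    by (rule sum.reindex_bij_betw[OF bij_betw_restrict_PiE_Union[OF assms(1)], symmetric])
  finally show ?thesis by simp
qed

lemma of_bool_Ball:
  "finite I \<Longrightarrow> (of_bool (\<forall>i\<in>I. R i) :: 'a :: comm_semiring_1) = (\<Prod>i\<in>I. of_bool (R i))"
  by (induction I rule: finite_induct) (simp_all add: of_bool_conj)

section \<open>Decomposition of a rooted tree at its root\<close>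

context rooted_tree
begin

lemma finite_out_arcs_root: "finite (out_arcs T \<rho>)"
  by (rule finite_subset[OF _ finite_arcs]) auto

lemma unique_walk: "awalk \<rho> p v \<Longrightarrow> awalk \<rho> q v \<Longrightarrow> p = q"
  using unique_awalk[of v] awalk_last_in_verts[of \<rho> p v] by blast

lemma mem_verts_child_iff: "w \<in> verts (subtree T (head T e)) \<longleftrightarrow> (\<exists>p. awalk (head T e) p w)"
  by (simp add: subtree_def reachable_awalk)

text \<open>The set of vertices reachable from \<open>v\<close> contains the head of an arc as soon
  as it contains the tail, so the tail alone decides whether the induced subgraph keeps the
  arc.\<close>

lemma arcs_child:
  "arcs (subtree T v) = {x \<in> arcs T. tail T x \<in> verts (subtree T v)}"
  by (auto simp: subtree_def dest: reachable_adj_trans in_arcs_imp_in_arcs_ends)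

lemma awalk_through_child:
  assumes "e \<in> out_arcs T \<rho>"
  shows "awalk \<rho> (e # p) w \<longleftrightarrow> awalk (head T e) p w"
  using assms by (auto simp: awalk_Cons_iff)

text \<open>Otherwise a nonempty walk would lead from the root to itself, besides the empty
  one.\<close>

lemma root_not_in_child:
  assumes "e \<in> out_arcs T \<rho>"
  shows "\<rho> \<notin> verts (subtree T (head T e))"
proof
  assume "\<rho> \<in> verts (subtree T (head T e))"
  then obtain p where "awalk \<rho> (e # p) \<rho>"
    using assms by (auto simp: mem_verts_child_iff awalk_through_child)
  then show False
    using unique_walk[of "e # p" \<rho> "[]"] root_in_verts by (simp add: awalk_Nil_iff)
qed

text \<open>A common vertex would be reached from the root by two walks with different first arcs.
  In particular two arcs at the root never share a head, so indexing children by arcs counts each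
  child once.\<close>

lemma disjoint_children:
  "disjoint_family_on (\<lambda>e. verts (subtree T (head T e))) (out_arcs T \<rho>)"
  unfolding disjoint_family_on_def
proof (intro ballI impI)
  fix e e' assume e: "e \<in> out_arcs T \<rho>" "e' \<in> out_arcs T \<rho>" "e \<noteq> e'"
  show "verts (subtree T (head T e)) \<inter> verts (subtree T (head T e')) = {}"
  proof (rule ccontr)
    assume "\<not> ?thesis"
    then obtain w p q where "awalk (head T e) p w" "awalk (head T e') q w"
      by (auto simp: mem_verts_child_iff)
    then have "e # p = e' # q"
      using unique_walk[of "e # p" w "e' # q"] e by (simp add: awalk_through_child)
    with e show False by simp
  qed
qed

lemma verts_decomp:
  "verts T = insert \<rho> (\<Union>e\<in>out_arcs T \<rho>. verts (subtree T (head T e)))"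
proof (intro set_eqI iffI)
  fix w assume "w \<in> verts T"
  then obtain p where p: "awalk \<rho> p w" using unique_awalk by blast
  show "w \<in> insert \<rho> (\<Union>e\<in>out_arcs T \<rho>. verts (subtree T (head T e)))"
  proof (cases p)
    case Nil
    then show ?thesis using p by (simp add: awalk_Nil_iff)
  next
    case (Cons e q)
    then have "e \<in> out_arcs T \<rho>" "awalk (head T e) q w" using p by (auto simp: awalk_Cons_iff)
    then show ?thesis by (auto simp: mem_verts_child_iff)
  qed
next
  fix w assume "w \<in> insert \<rho> (\<Union>e\<in>out_arcs T \<rho>. verts (subtree T (head T e)))"
  then show "w \<in> verts T"
    using root_in_verts awalk_last_in_verts by (auto simp: mem_verts_child_iff)
qed

lemma arcs_decomp:
  "arcs T = out_arcs T \<rho> \<union> (\<Union>e\<in>out_arcs T \<rho>. arcs (subtree T (head T e)))"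
proof -
  have "x \<in> out_arcs T \<rho> \<union> (\<Union>e\<in>out_arcs T \<rho>. arcs (subtree T (head T e)))" if "x \<in> arcs T" for x
    using tail_in_verts[OF that] that by (subst (asm) verts_decomp) (auto simp: arcs_child)
  moreover have "out_arcs T \<rho> \<union> (\<Union>e\<in>out_arcs T \<rho>. arcs (subtree T (head T e))) \<subseteq> arcs T"
    by (auto simp: arcs_child)
  ultimately show ?thesis by blast
qed

text \<open>A walk from \<open>v\<close> only visits vertices reachable from \<open>v\<close>. Hence
  levels computed inside a subtree can be described by walks of \<open>T\<close>.\<close>

lemma awalk_child_iff:
  "pre_digraph.awalk (subtree T v) v p w \<longleftrightarrow> awalk v p w"
proof
  assume "awalk v p w"
  then show "pre_digraph.awalk (subtree T v) v p w"
    unfolding subtree_def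
    by (intro awalk_induce) (auto dest: awalk_verts_reachable_from)
next
  assume *: "pre_digraph.awalk (subtree T v) v p w"
  have "subgraph (subtree T v) T"
    unfolding subtree_def
    by (intro subgraph_induce_subgraphI) (auto dest: reachable_in_verts)
  then show "awalk v p w"
    using * cas_subset[of "subtree T v" v p w T] by (auto simp: pre_digraph.awalk_def)
qed

text \<open>Deleting the first arc of a walk from the root leaves a walk from a child that is
  shorter by one.\<close>

lemma level_Suc:
  "level T \<rho> (Suc k) = (\<Union>e\<in>out_arcs T \<rho>. level (subtree T (head T e)) (head T e) k)"
proof (intro set_eqI iffI)
  fix w assume "w \<in> level T \<rho> (Suc k)"
  then obtain e q where "awalk \<rho> (e # q) w" "length q = k"
    by (auto simp: level_def length_Suc_conv)
  then show "w \<in> (\<Union>e\<in>out_arcs T \<rho>. level (subtree T (head T e)) (head T e) k)"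
    by (auto simp: level_def awalk_child_iff mem_verts_child_iff awalk_Cons_iff intro!: bexI[of _ e])
next
  fix w assume "w \<in> (\<Union>e\<in>out_arcs T \<rho>. level (subtree T (head T e)) (head T e) k)"
  then obtain e q where e: "e \<in> out_arcs T \<rho>" and q: "awalk (head T e) q w" "length q = k"
    by (auto simp: level_def awalk_child_iff)
  then have "awalk \<rho> (e # q) w" by (simp add: awalk_through_child)
  then show "w \<in> level T \<rho> (Suc k)"
    using q awalk_last_in_verts unfolding level_def by (metis (mono_tags, lifting) mem_Collect_eq length_Cons)
qed

lemma disjoint_child_levels:
  "disjoint_family_on (\<lambda>e. level (subtree T (head T e)) (head T e) k) (out_arcs T \<rho>)"
  using disjoint_children by (auto simp: disjoint_family_on_def level_def)

text \<open>Every arc either leaves the root or lies in exactly one subtree. Restricting the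
  configuration makes it an extensional function on the subtree, as \<open>configs\<close>
  demands.\<close>

lemma weight_decomp:
  "weight T \<Psi> \<sigma> = (\<Prod>e\<in>out_arcs T \<rho>. \<Psi> e (\<sigma> \<rho>) (\<sigma> (head T e))
      * weight (subtree T (head T e)) \<Psi> (restrict \<sigma> (verts (subtree T (head T e)))))"
proof -
  let ?S = "\<lambda>e. subtree T (head T e)" and ?f = "\<lambda>x. \<Psi> x (\<sigma> (tail T x)) (\<sigma> (head T x))"
  have child: "prod ?f (arcs (?S e)) = weight (?S e) \<Psi> (restrict \<sigma> (verts (?S e)))" for e
    unfolding weight_def by (intro prod.cong) (auto simp: subtree_def)
  have "prod ?f (\<Union>e\<in>out_arcs T \<rho>. arcs (?S e)) = (\<Prod>e\<in>out_arcs T \<rho>. prod ?f (arcs (?S e)))"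
  proof (rule prod.UNION_disjoint)
    show "\<forall>e\<in>out_arcs T \<rho>. \<forall>e'\<in>out_arcs T \<rho>. e \<noteq> e' \<longrightarrow> arcs (?S e) \<inter> arcs (?S e') = {}"
      using disjoint_children by (auto simp: arcs_child disjoint_family_on_def)
  qed (auto simp: arcs_child)
  moreover have "out_arcs T \<rho> \<inter> (\<Union>e\<in>out_arcs T \<rho>. arcs (?S e)) = {}"
    using root_not_in_child by (auto simp: arcs_child)
  moreover have "finite (\<Union>e\<in>out_arcs T \<rho>. arcs (?S e))" "finite (out_arcs T \<rho>)"
    by (auto intro: finite_subset[OF _ finite_arcs] simp: arcs_child)
  ultimately have "weight T \<Psi> \<sigma> = prod ?f (out_arcs T \<rho>) * (\<Prod>e\<in>out_arcs T \<rho>. prod ?f (arcs (?S e)))"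
    unfolding weight_def by (subst arcs_decomp) (simp add: prod.union_disjoint)
  also have "prod ?f (out_arcs T \<rho>) = (\<Prod>e\<in>out_arcs T \<rho>. \<Psi> e (\<sigma> \<rho>) (\<sigma> (head T e)))"
    by (rule prod.cong) auto
  finally show ?thesis by (simp add: child prod.distrib)
qed

end

section \<open>Boundary weights and posteriors\<close>

text \<open>This is \<open>W\<^sup>a(L)\<close>. The nested comprehension has the shape in which
  \<open>sum.group\<close> splits a sum according to the root spin.\<close>

definition boundary_weight ::
    "('v, 'e) pre_digraph \<Rightarrow> 'v \<Rightarrow> ('v \<Rightarrow> 's set) \<Rightarrow> ('e \<Rightarrow> 's \<Rightarrow> 's \<Rightarrow> real) \<Rightarrow> nat
      \<Rightarrow> ('v \<Rightarrow> 's) \<Rightarrow> 's \<Rightarrow> real" where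
  "boundary_weight T \<rho> D \<Psi> m L a =
     sum (weight T \<Psi>) {\<sigma> \<in> {\<sigma> \<in> configs T D. restrict \<sigma> (level T \<rho> m) = L}. \<sigma> \<rho> = a}"

definition boundary_pmf ::
    "('v, 'e) pre_digraph \<Rightarrow> 'v \<Rightarrow> ('v \<Rightarrow> 's set) \<Rightarrow> ('e \<Rightarrow> 's \<Rightarrow> 's \<Rightarrow> real) \<Rightarrow> nat
      \<Rightarrow> ('v \<Rightarrow> 's) pmf" where
  "boundary_pmf T \<rho> D \<Psi> m = map_pmf (\<lambda>\<sigma>. restrict \<sigma> (level T \<rho> m)) (gibbs T D \<Psi>)"

text \<open>Summing over \<open>A\<close> identifies the factor as the total mass of
  \<open>x\<close>, because \<open>\<eta>\<close> sums to 1. This removes the existential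
  quantifier, which helps both with measurability and with normalizing \<open>f\<close>.\<close>

lemma proportional_on_prob_vector_iff:
  assumes \<eta>: "\<eta> \<in> prob_vectors A"
  shows "proportional_on A x \<eta> \<longleftrightarrow> 0 < total_mass A x \<and> (\<forall>a\<in>A. x a = total_mass A x * \<eta> a)"
proof
  assume "proportional_on A x \<eta>"
  then obtain k where k: "k > 0" "\<forall>a\<in>A. x a = k * \<eta> a" by (auto simp: proportional_on_def)
  have "total_mass A x = k * (\<Sum>a\<in>A. \<eta> a)"
    using k(2) by (simp add: total_mass_def sum_distrib_left)
  also have "(\<Sum>a\<in>A. \<eta> a) = 1"
    using \<eta> by (simp add: prob_vectors_def)
  finally show "0 < total_mass A x \<and> (\<forall>a\<in>A. x a = total_mass A x * \<eta> a)"
    using k by simp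
qed (auto simp: proportional_on_def)

lemma singleton_in_sets_vec_borel:
  assumes "finite A" "\<eta> \<in> extensional A"
  shows "{\<eta>} \<in> sets (vec_borel A)"
proof -
  have "{\<eta>} = PiE A (\<lambda>a. {\<eta> a})"
    using PiE_singleton[OF assms(2)] by simp
  then show ?thesis using assms(1) by (auto intro: sets_PiM_I_finite)
qed

lemma root_posterior_measurable:
  "root_posterior T \<rho> D \<Psi> m \<in> measurable (count_space UNIV) (vec_borel (D \<rho>))"
  unfolding root_posterior_def[abs_def] by (intro measurable_restrict) simp

text \<open>Drawing the boundary condition first exhibits the residual distribution as the image of
  a finitely supported law, the form that the expectation formula for independent vectors
  takes.\<close>

lemma residual_dist_eq:
  "residual_dist T \<rho> D \<Psi> m
    = distr (measure_pmf (boundary_pmf T \<rho> D \<Psi> m)) (vec_borel (D \<rho>)) (root_posterior T \<rho> D \<Psi> m)"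
proof -
  have "residual_dist T \<rho> D \<Psi> m = distr (distr (measure_pmf (gibbs T D \<Psi>)) (count_space UNIV)
      (\<lambda>\<tau>. restrict \<tau> (level T \<rho> m))) (vec_borel (D \<rho>)) (root_posterior T \<rho> D \<Psi> m)"
    unfolding residual_dist_def
    by (subst distr_distr[OF root_posterior_measurable]) (auto simp: comp_def)
  then show ?thesis by (simp add: boundary_pmf_def map_pmf_rep_eq)
qed

context mrf
begin

lemma set_gibbs: "set_pmf (gibbs T D \<Psi>) \<subseteq> configs T D"
  by (auto simp: set_pmf_eq pmf_gibbs split: if_splits)

lemma measure_gibbs:
  "measure (measure_pmf (gibbs T D \<Psi>)) A = sum (weight T \<Psi>) {\<sigma> \<in> configs T D. \<sigma> \<in> A} / partition_fun T D \<Psi>"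
proof -
  have "measure (measure_pmf (gibbs T D \<Psi>)) A = measure (measure_pmf (gibbs T D \<Psi>)) {\<sigma> \<in> configs T D. \<sigma> \<in> A}"
    using set_gibbs by (intro measure_pmf.finite_measure_eq_AE AE_pmfI) auto
  also have "\<dots> = (\<Sum>\<sigma>\<in>{\<sigma> \<in> configs T D. \<sigma> \<in> A}. pmf (gibbs T D \<Psi>) \<sigma>)"
    using finite_configs by (intro measure_measure_pmf_finite) auto
  also have "\<dots> = sum (weight T \<Psi>) {\<sigma> \<in> configs T D. \<sigma> \<in> A} / partition_fun T D \<Psi>"
    by (simp add: pmf_gibbs sum_divide_distrib)
  finally show ?thesis .
qed

lemma boundary_weight_nonneg: "0 \<le> boundary_weight T \<rho> D \<Psi> m L a"
  unfolding boundary_weight_def by (intro sum_nonneg weight_nonneg) auto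

lemma set_boundary_pmf: "set_pmf (boundary_pmf T \<rho> D \<Psi> m) \<subseteq> (\<Pi>\<^sub>E v\<in>level T \<rho> m. D v)"
proof -
  have "restrict \<sigma> (level T \<rho> m) \<in> (\<Pi>\<^sub>E v\<in>level T \<rho> m. D v)" if "\<sigma> \<in> configs T D" for \<sigma>
    using that by (auto simp: configs_def level_def)
  then show ?thesis
    using set_gibbs unfolding boundary_pmf_def set_map_pmf by (blast intro: image_subsetI)
qed

lemma finite_boundaries: "finite (\<Pi>\<^sub>E v\<in>level T \<rho> m. D v)"
  by (intro finite_PiE finite_subset[OF _ finite_verts] finite_domain) (auto simp: level_def)

context
  fixes \<rho>
  assumes \<rho>: "\<rho> \<in> verts T"
begin

lemma total_mass_boundary_weight:
  "total_mass (D \<rho>) (boundary_weight T \<rho> D \<Psi> m L)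
    = sum (weight T \<Psi>) {\<sigma> \<in> configs T D. restrict \<sigma> (level T \<rho> m) = L}"
  unfolding total_mass_def boundary_weight_def
proof (rule sum.group)
  show "(\<lambda>\<sigma>. \<sigma> \<rho>) ` {\<sigma> \<in> configs T D. restrict \<sigma> (level T \<rho> m) = L} \<subseteq> D \<rho>"
    using \<rho> by (auto simp: configs_def)
qed (use \<rho> finite_configs finite_domain in auto)

lemma pmf_boundary:
  "pmf (boundary_pmf T \<rho> D \<Psi> m) L
    = total_mass (D \<rho>) (boundary_weight T \<rho> D \<Psi> m L) / partition_fun T D \<Psi>"
  unfolding boundary_pmf_def pmf_map measure_gibbs total_mass_boundary_weight by simp

lemma root_posterior_eq:
  assumes "a \<in> D \<rho>"
  shows "root_posterior T \<rho> D \<Psi> m L a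
    = boundary_weight T \<rho> D \<Psi> m L a / total_mass (D \<rho>) (boundary_weight T \<rho> D \<Psi> m L)"
proof -
  have "{\<sigma> \<in> configs T D. \<sigma> \<rho> = a \<and> restrict \<sigma> (level T \<rho> m) = L}
      = {\<sigma> \<in> {\<sigma> \<in> configs T D. restrict \<sigma> (level T \<rho> m) = L}. \<sigma> \<rho> = a}"
    by auto
  then show ?thesis
    using assms partition_fun_pos
    by (simp add: root_posterior_def cond_prob_def measure_gibbs boundary_weight_def
        total_mass_boundary_weight)
qed

text \<open>
  This includes boundary conditions of probability 0, where the posterior is \<open>0 / 0 = 0\<close>,
  because all their weights vanish.
\<close>

lemma boundary_weight_eq_posterior:
  assumes a: "a \<in> D \<rho>"
  shows "boundary_weight T \<rho> D \<Psi> m L a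
    = total_mass (D \<rho>) (boundary_weight T \<rho> D \<Psi> m L) * root_posterior T \<rho> D \<Psi> m L a"
proof (cases "total_mass (D \<rho>) (boundary_weight T \<rho> D \<Psi> m L) = 0")
  case True
  then have "boundary_weight T \<rho> D \<Psi> m L a = 0"
    using a finite_domain[OF \<rho>] boundary_weight_nonneg
    by (auto simp: total_mass_def sum_nonneg_eq_0_iff)
  then show ?thesis by (simp add: root_posterior_eq a)
qed (simp add: root_posterior_eq a)

end

end

section \<open>Recursion from the children to the root\<close>

locale rooted_tree_mrf = rooted_tree T \<rho> + mrf T D \<Psi>
  for T :: "('v, 'e) pre_digraph" and \<rho> :: 'v and D :: "'v \<Rightarrow> 's set"
    and \<Psi> :: "'e \<Rightarrow> 's \<Rightarrow> 's \<Rightarrow> real"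
begin

abbreviation child :: "'e \<Rightarrow> ('v, 'e) pre_digraph" where
  "child e \<equiv> subtree T (head T e)"

lemma head_in_child: "e \<in> out_arcs T \<rho> \<Longrightarrow> head T e \<in> verts (child e)"
  by (auto simp: mem_verts_child_iff awalk_Nil_iff intro!: exI[of _ "[]"])

lemma verts_child_subset: "e \<in> out_arcs T \<rho> \<Longrightarrow> verts (child e) \<subseteq> verts T"
  using verts_decomp by blast

lemma restrict_in_configs_child:
  "\<sigma> \<in> configs T D \<Longrightarrow> e \<in> out_arcs T \<rho> \<Longrightarrow> restrict \<sigma> (verts (child e)) \<in> configs (child e) D"
  using verts_child_subset[of e] by (auto simp: configs_def)

text \<open>The point is that the partition function of the subtree is positive: some configuration
  of \<open>T\<close> has nonzero weight, and the weight of its restriction to the subtree is a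
  factor of that weight.\<close>

lemma mrf_child:
  assumes e: "e \<in> out_arcs T \<rho>"
  shows "mrf (child e) D \<Psi>"
proof -
  interpret S: wf_digraph "child e"
    unfolding subtree_def by (rule wellformed_induce_subgraph)
  interpret S: fin_digraph "child e"
  proof
    show "finite (verts (child e))"
      using verts_child_subset[OF e] finite_verts by (rule finite_subset)
    show "finite (arcs (child e))"
      by (rule finite_subset[OF _ finite_arcs]) (simp add: arcs_child)
  qed
  \<comment> \<open>\<open>weight_nonneg\<close> applies only to a field with positive partition
    function, which is still to be shown for \<open>child e\<close>.\<close>
  have nonneg: "0 \<le> weight (child e) \<Psi> \<tau>" if "\<tau> \<in> configs (child e) D" for \<tau>
    unfolding weight_def
  proof (rule prod_nonneg)
    fix x assume x: "x \<in> arcs (child e)"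
    have "\<tau> (tail T x) \<in> D (tail T x)" "\<tau> (head T x) \<in> D (head T x)"
      using that S.tail_in_verts[OF x] S.head_in_verts[OF x]
      by (auto simp: configs_def subtree_def)
    then show "0 \<le> \<Psi> x (\<tau> (tail (child e) x)) (\<tau> (head (child e) x))"
      using x potential_nonneg[of x] by (auto simp: subtree_def)
  qed
  obtain \<sigma> where \<sigma>: "\<sigma> \<in> configs T D" "weight T \<Psi> \<sigma> \<noteq> 0"
    using partition_fun_pos unfolding partition_fun_def by (metis less_irrefl sum.neutral)
  let ?\<tau> = "restrict \<sigma> (verts (child e))"
  have "weight (child e) \<Psi> ?\<tau> \<noteq> 0"
    using \<sigma>(2) e finite_out_arcs_root by (auto simp: weight_decomp)
  moreover have "finite (configs (child e) D)"
    unfolding configs_def using verts_child_subset[OF e] finite_domain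
    by (intro finite_PiE S.finite_verts) auto
  ultimately have "0 < partition_fun (child e) D \<Psi>"
    unfolding partition_fun_def
    using restrict_in_configs_child[OF \<sigma>(1) e] nonneg
    by (intro sum_pos2[of _ ?\<tau>]) (auto simp: less_le)
  then show ?thesis
    using verts_child_subset[OF e] finite_domain potential_nonneg
    by unfold_locales (auto simp: arcs_child subtree_def)
qed

text \<open>Once the root spin is \<open>a\<close>, the weight and the boundary constraint both
  factor over the subtrees, so the sum over configurations is a product of sums. Each of these is
  then grouped by the spin of the child.\<close>

lemma boundary_weight_Suc:
  assumes L: "L \<in> (\<Pi>\<^sub>E v\<in>level T \<rho> (Suc k). D v)" and a: "a \<in> D \<rho>"
  shows "boundary_weight T \<rho> D \<Psi> (Suc k) L a = (\<Prod>e\<in>out_arcs T \<rho>. \<Sum>s\<in>D (head T e).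
    boundary_weight (child e) (head T e) D \<Psi> k (restrict L (level (child e) (head T e) k)) s * \<Psi> e a s)"
proof -
  let ?I = "out_arcs T \<rho>" and ?U = "\<Union>e\<in>out_arcs T \<rho>. verts (child e)"
  let ?lev = "\<lambda>e. level (child e) (head T e) k"
  \<comment> \<open>The contribution of one subtree, with its share of the boundary constraint as an
    indicator.\<close>
  define F where "F e \<tau> = of_bool (restrict \<tau> (?lev e) = restrict L (?lev e))
    * (\<Psi> e a (\<tau> (head T e)) * weight (child e) \<Psi> \<tau>)" for e \<tau>
  have lev_sub: "?lev e \<subseteq> verts (child e)" for e by (auto simp: level_def)
  have fin: "finite (configs (child e) D)" if "e \<in> ?I" for e
    using mrf.finite_configs[OF mrf_child[OF that]] .
  have root: "\<rho> \<notin> ?U" using root_not_in_child by blast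
  \<comment> \<open>The constraint splits over the subtrees by \<open>level_Suc\<close>; as
    \<open>L\<close> is extensional, equality means agreement on the level.\<close>
  have split: "restrict \<sigma> (level T \<rho> (Suc k)) = L
      \<longleftrightarrow> (\<forall>e\<in>?I. restrict \<sigma> (?lev e) = restrict L (?lev e))" for \<sigma>
  proof -
    have "restrict \<sigma> (level T \<rho> (Suc k)) = L \<longleftrightarrow> (\<forall>v\<in>level T \<rho> (Suc k). \<sigma> v = L v)"
      using L by (auto simp: PiE_iff extensional_def fun_eq_iff)
    also have "\<dots> \<longleftrightarrow> (\<forall>e\<in>?I. \<forall>v\<in>?lev e. \<sigma> v = L v)"
      unfolding level_Suc by blast
    finally show ?thesis by (auto simp: restrict_def fun_eq_iff)
  qed
  \<comment> \<open>A configuration with root spin \<open>a\<close> is a configuration of the union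
    of the subtrees, updated at the root, where it was \<open>undefined\<close> before.\<close>
  have configs_eq: "{\<sigma> \<in> configs T D. \<sigma> \<rho> = a} = (\<lambda>g. g(\<rho> := a)) ` PiE ?U D"
    (is "?l = ?r")
  proof
    show "?l \<subseteq> ?r"
      unfolding configs_def verts_decomp PiE_insert_eq by auto
    show "?r \<subseteq> ?l"
      unfolding configs_def verts_decomp PiE_insert_eq using a by auto
  qed
  have inj: "inj_on (\<lambda>g. g(\<rho> := a)) (PiE ?U D)"
  proof (rule inj_onI)
    fix g h assume "g \<in> PiE ?U D" "h \<in> PiE ?U D" "g(\<rho> := a) = h(\<rho> := a)"
    then show "g = h"
      using root by (metis (no_types, lifting) PiE_arb fun_upd_idem_iff fun_upd_upd)
  qed
  have "boundary_weight T \<rho> D \<Psi> (Suc k) L a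
      = (\<Sum>\<sigma>\<in>{\<sigma> \<in> configs T D. \<sigma> \<rho> = a}. of_bool (restrict \<sigma> (level T \<rho> (Suc k)) = L) * weight T \<Psi> \<sigma>)"
    unfolding boundary_weight_def using finite_configs
    by (intro sum.mono_neutral_cong_left) auto
  also have "\<dots> = (\<Sum>g\<in>PiE ?U D. of_bool (restrict (g(\<rho> := a)) (level T \<rho> (Suc k)) = L)
      * weight T \<Psi> (g(\<rho> := a)))"
    unfolding configs_eq sum.reindex[OF inj] by simp
  also have "\<dots> = (\<Sum>g\<in>PiE ?U D. \<Prod>e\<in>?I. F e (restrict g (verts (child e))))"
  proof (rule sum.cong[OF refl])
    fix g
    have 1: "restrict (g(\<rho> := a)) V = restrict g V" if "\<rho> \<notin> V" for V
      using that by (auto simp: restrict_def fun_eq_iff)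
    have 2: "restrict (g(\<rho> := a)) (verts (child e)) = restrict g (verts (child e))"
        "restrict (g(\<rho> := a)) (?lev e) = restrict g (?lev e)"
        "(g(\<rho> := a)) (head T e) = g (head T e)" if "e \<in> ?I" for e
      using that root_not_in_child[OF that] lev_sub[of e] head_in_child[OF that]
      by (auto intro!: 1)
    have "of_bool (restrict (g(\<rho> := a)) (level T \<rho> (Suc k)) = L)
        = (\<Prod>e\<in>?I. of_bool (restrict g (?lev e) = restrict L (?lev e)) :: real)"
      unfolding split of_bool_Ball[OF finite_out_arcs_root] using 2(2) by (intro prod.cong) auto
    moreover have "weight T \<Psi> (g(\<rho> := a)) = (\<Prod>e\<in>?I. \<Psi> e a (g (head T e))
        * weight (child e) \<Psi> (restrict g (verts (child e))))"
      unfolding weight_decomp by (intro prod.cong refl) (simp add: 2 del: fun_upd_apply, simp)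
    moreover have "F e (restrict g (verts (child e)))
        = of_bool (restrict g (?lev e) = restrict L (?lev e)) * (\<Psi> e a (g (head T e))
        * weight (child e) \<Psi> (restrict g (verts (child e))))" if "e \<in> ?I" for e
      using head_in_child[OF that] lev_sub[of e] by (simp add: F_def Int_absorb1)
    ultimately show "of_bool (restrict (g(\<rho> := a)) (level T \<rho> (Suc k)) = L) * weight T \<Psi> (g(\<rho> := a))
        = (\<Prod>e\<in>?I. F e (restrict g (verts (child e))))"
      by (simp add: prod.distrib)
  qed
  also have "\<dots> = (\<Prod>e\<in>?I. \<Sum>\<tau>\<in>configs (child e) D. F e \<tau>)"
    unfolding configs_def
    by (intro sum_PiE_Union disjoint_children) (use fin in \<open>auto simp: configs_def\<close>)
  also have "\<dots> = (\<Prod>e\<in>?I. \<Sum>s\<in>D (head T e).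
    boundary_weight (child e) (head T e) D \<Psi> k (restrict L (?lev e)) s * \<Psi> e a s)"
  proof (rule prod.cong[OF refl])
    fix e assume e: "e \<in> ?I"
    let ?C = "{\<tau> \<in> configs (child e) D. restrict \<tau> (?lev e) = restrict L (?lev e)}"
    have head: "head T e \<in> verts (child e)" by (rule head_in_child[OF e])
    have "(\<Sum>\<tau>\<in>configs (child e) D. F e \<tau>) = (\<Sum>\<tau>\<in>?C. \<Psi> e a (\<tau> (head T e)) * weight (child e) \<Psi> \<tau>)"
      using fin[OF e] by (intro sum.mono_neutral_cong_right) (auto simp: F_def)
    also have "\<dots> = (\<Sum>s\<in>D (head T e). \<Sum>\<tau>\<in>{\<tau> \<in> ?C. \<tau> (head T e) = s}.
        \<Psi> e a (\<tau> (head T e)) * weight (child e) \<Psi> \<tau>)"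
    proof (rule sum.group[symmetric])
      show "(\<lambda>\<tau>. \<tau> (head T e)) ` ?C \<subseteq> D (head T e)"
        using head by (auto simp: configs_def)
    qed (use fin[OF e] head mrf.finite_domain[OF mrf_child[OF e]] in auto)
    also have "\<dots> = (\<Sum>s\<in>D (head T e).
        boundary_weight (child e) (head T e) D \<Psi> k (restrict L (?lev e)) s * \<Psi> e a s)"
      unfolding boundary_weight_def sum_distrib_right by (intro sum.cong refl) auto
    finally show "(\<Sum>\<tau>\<in>configs (child e) D. F e \<tau>) = (\<Sum>s\<in>D (head T e).
        boundary_weight (child e) (head T e) D \<Psi> k (restrict L (?lev e)) s * \<Psi> e a s)" .
  qed
  finally show ?thesis .
qed

text \<open>The vectors \<open>\<eta>\<^sub>1, \<dots>, \<eta>\<^sub>r\<close> that the parts of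
  \<open>L\<close> induce at the children.\<close>

abbreviation child_posteriors :: "nat \<Rightarrow> ('v \<Rightarrow> 's) \<Rightarrow> 'e \<Rightarrow> 's \<Rightarrow> real" where
  "child_posteriors k L \<equiv> (\<lambda>e\<in>out_arcs T \<rho>.
     root_posterior (child e) (head T e) D \<Psi> k (restrict L (level (child e) (head T e) k)))"

text \<open>Each child weight is its total mass times its posterior, and the total mass leaves the
  sum over spins. Nothing is divided, so parts of \<open>L\<close> of probability 0 are
  covered.\<close>

lemma boundary_weight_bp_map:
  assumes L: "L \<in> (\<Pi>\<^sub>E v\<in>level T \<rho> (Suc k). D v)" and a: "a \<in> D \<rho>"
  shows "boundary_weight T \<rho> D \<Psi> (Suc k) L a
    = (\<Prod>e\<in>out_arcs T \<rho>. total_mass (D (head T e)) (boundary_weight (child e) (head T e) D \<Psi> k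
        (restrict L (level (child e) (head T e) k))))
      * bp_map T \<rho> D \<Psi> (child_posteriors k L) a"
proof -
  have "(\<Sum>s\<in>D (head T e). boundary_weight (child e) (head T e) D \<Psi> k
        (restrict L (level (child e) (head T e) k)) s * \<Psi> e a s)
      = total_mass (D (head T e)) (boundary_weight (child e) (head T e) D \<Psi> k
        (restrict L (level (child e) (head T e) k)))
        * (\<Sum>s\<in>D (head T e). child_posteriors k L e s * \<Psi> e a s)"
    if e: "e \<in> out_arcs T \<rho>" for e
    unfolding sum_distrib_left
  proof (rule sum.cong[OF refl])
    fix s assume "s \<in> D (head T e)"
    from mrf.boundary_weight_eq_posterior[OF mrf_child[OF e] head_in_child[OF e] this,
        of k "restrict L (level (child e) (head T e) k)"]
    show "boundary_weight (child e) (head T e) D \<Psi> k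
        (restrict L (level (child e) (head T e) k)) s * \<Psi> e a s
      = total_mass (D (head T e)) (boundary_weight (child e) (head T e) D \<Psi> k
        (restrict L (level (child e) (head T e) k))) * (child_posteriors k L e s * \<Psi> e a s)"
      using e by simp
  qed
  then show ?thesis
    unfolding boundary_weight_Suc[OF assms] using a by (simp add: bp_map_def prod.distrib)
qed

text \<open>Proportionality to a probability vector amounts to one inequality and finitely many
  equations between measurable functions.\<close>

lemma bp_map_integrand_measurable:
  assumes \<eta>: "\<eta> \<in> prob_vectors (D \<rho>)"
  shows "(\<lambda>y. total_mass (D \<rho>) (bp_map T \<rho> D \<Psi> y)
      * of_bool (proportional_on (D \<rho>) (bp_map T \<rho> D \<Psi> y) \<eta>))
    \<in> borel_measurable (PiM (out_arcs T \<rho>) (\<lambda>e. vec_borel (D (head T e))))"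
    (is "_ \<in> borel_measurable ?N")
proof -
  have bp: "(\<lambda>y. bp_map T \<rho> D \<Psi> y a) \<in> borel_measurable ?N" if a: "a \<in> D \<rho>" for a
  proof -
    have "(\<lambda>y. y e s) \<in> borel_measurable ?N" if "e \<in> out_arcs T \<rho>" "s \<in> D (head T e)" for e s
      using that
      by (intro measurable_compose[where f = "\<lambda>y. y e" and g = "\<lambda>x. x s"]) measurable
    then show ?thesis
      using a unfolding bp_map_def
      by (auto intro!: borel_measurable_prod borel_measurable_sum borel_measurable_times)
  qed
  have mass [measurable]: "(\<lambda>y. total_mass (D \<rho>) (bp_map T \<rho> D \<Psi> y)) \<in> borel_measurable ?N"
    unfolding total_mass_def by (intro borel_measurable_sum bp)
  have fin: "finite (D \<rho>)" using finite_domain root_in_verts .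
  have eq: "Measurable.pred ?N (\<lambda>y. bp_map T \<rho> D \<Psi> y a = total_mass (D \<rho>) (bp_map T \<rho> D \<Psi> y) * \<eta> a)"
    if "a \<in> D \<rho>" for a
    unfolding pred_def by (intro borel_measurable_eq borel_measurable_times bp that mass) simp
  have [measurable]: "Measurable.pred ?N (\<lambda>y. proportional_on (D \<rho>) (bp_map T \<rho> D \<Psi> y) \<eta>)"
    unfolding proportional_on_prob_vector_iff[OF \<eta>]
    by (intro pred_intros_logic pred_intros_finite fin eq) measurable
  show ?thesis unfolding of_bool_def by measurable
qed

text \<open>The claim for a single boundary condition; the theorem is its sum over
  \<open>L\<close>.\<close>

lemma boundary_term:
  assumes L: "L \<in> (\<Pi>\<^sub>E v\<in>level T \<rho> (Suc k). D v)" and \<eta>: "\<eta> \<in> prob_vectors (D \<rho>)"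
  shows "pmf (boundary_pmf T \<rho> D \<Psi> (Suc k)) L * of_bool (root_posterior T \<rho> D \<Psi> (Suc k) L = \<eta>)
    = (\<Prod>e\<in>out_arcs T \<rho>. partition_fun (child e) D \<Psi>) / partition_fun T D \<Psi>
      * ((\<Prod>e\<in>out_arcs T \<rho>. pmf (boundary_pmf (child e) (head T e) D \<Psi> k)
            (restrict L (level (child e) (head T e) k)))
        * (total_mass (D \<rho>) (bp_map T \<rho> D \<Psi> (child_posteriors k L))
          * of_bool (proportional_on (D \<rho>) (bp_map T \<rho> D \<Psi> (child_posteriors k L)) \<eta>)))"
proof -
  let ?W = "boundary_weight T \<rho> D \<Psi> (Suc k) L" and ?f = "bp_map T \<rho> D \<Psi> (child_posteriors k L)"
  \<comment> \<open>\<open>B\<close> is the product of the \<open>W\<^sub>i(L\<^sub>i)\<close> and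
    \<open>K\<close> that of the \<open>Z\<^sub>i\<close>, so \<open>B / K\<close> is the
    probability of \<open>L\<close> under independent fields on the subtrees.\<close>
  define B where "B = (\<Prod>e\<in>out_arcs T \<rho>. total_mass (D (head T e))
    (boundary_weight (child e) (head T e) D \<Psi> k (restrict L (level (child e) (head T e) k))))"
  define K where "K = (\<Prod>e\<in>out_arcs T \<rho>. partition_fun (child e) D \<Psi>)"
  have K: "K > 0"
    unfolding K_def using mrf.partition_fun_pos[OF mrf_child] by (intro prod_pos) auto
  have B: "B \<ge> 0"
    unfolding B_def total_mass_def
    by (intro prod_nonneg sum_nonneg) (auto intro: mrf.boundary_weight_nonneg[OF mrf_child])
  have W: "?W a = B * ?f a" if "a \<in> D \<rho>" for a
    using boundary_weight_bp_map[OF L that] by (simp add: B_def)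
  have mass: "total_mass (D \<rho>) ?W = B * total_mass (D \<rho>) ?f"
    by (simp add: total_mass_def W sum_distrib_left)
  have children: "(\<Prod>e\<in>out_arcs T \<rho>. pmf (boundary_pmf (child e) (head T e) D \<Psi> k)
      (restrict L (level (child e) (head T e) k))) = B / K"
    unfolding B_def K_def prod_dividef[symmetric]
    by (intro prod.cong refl mrf.pmf_boundary[OF mrf_child head_in_child])
  \<comment> \<open>If \<open>L\<close> has positive weight, then \<open>B\<close> cancels and the
    posterior is \<open>f / \<parallel>f\<parallel>\<close>.\<close>
  have "root_posterior T \<rho> D \<Psi> (Suc k) L = \<eta> \<longleftrightarrow> proportional_on (D \<rho>) ?f \<eta>"
    if nz: "total_mass (D \<rho>) ?W \<noteq> 0"
  proof -
    have "total_mass (D \<rho>) ?W \<ge> 0"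
      unfolding total_mass_def by (intro sum_nonneg boundary_weight_nonneg)
    then have pos: "B > 0" "total_mass (D \<rho>) ?f > 0"
      using nz B by (auto simp: mass zero_le_mult_iff)
    have ext: "root_posterior T \<rho> D \<Psi> (Suc k) L \<in> extensional (D \<rho>)" "\<eta> \<in> extensional (D \<rho>)"
      using \<eta> by (auto simp: root_posterior_def prob_vectors_def PiE_iff)
    have "root_posterior T \<rho> D \<Psi> (Suc k) L = \<eta>
        \<longleftrightarrow> (\<forall>a\<in>D \<rho>. root_posterior T \<rho> D \<Psi> (Suc k) L a = \<eta> a)"
      using ext by (auto intro: extensionalityI)
    also have "\<dots> \<longleftrightarrow> (\<forall>a\<in>D \<rho>. ?f a = total_mass (D \<rho>) ?f * \<eta> a)"
    proof (rule ball_cong[OF refl])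
      fix a assume a: "a \<in> D \<rho>"
      have "root_posterior T \<rho> D \<Psi> (Suc k) L a = ?f a / total_mass (D \<rho>) ?f"
        using pos by (simp add: root_posterior_eq root_in_verts a W mass)
      then show "root_posterior T \<rho> D \<Psi> (Suc k) L a = \<eta> a \<longleftrightarrow> ?f a = total_mass (D \<rho>) ?f * \<eta> a"
        using pos by (auto simp: field_simps)
    qed
    finally show ?thesis
      using pos by (simp add: proportional_on_prob_vector_iff[OF \<eta>])
  qed
  \<comment> \<open>If \<open>L\<close> has weight 0, the equivalence may fail, but both sides
    vanish since \<open>B * \<parallel>f\<parallel> = 0\<close>.\<close>
  then have "total_mass (D \<rho>) ?W * of_bool (root_posterior T \<rho> D \<Psi> (Suc k) L = \<eta>)
      = B * (total_mass (D \<rho>) ?f * of_bool (proportional_on (D \<rho>) ?f \<eta>))"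
    by (cases "total_mass (D \<rho>) ?W = 0") (auto simp: mass)
  then show ?thesis
    using K unfolding children K_def[symmetric] pmf_boundary[OF root_in_verts]
    by (simp add: field_simps)
qed

end

section \<open>Summation over boundary conditions\<close>

theorem theorem1:
  fixes T :: "('v, 'e) pre_digraph" and \<rho> :: 'v and m :: nat
    and D :: "'v \<Rightarrow> 's set" and \<Psi> :: "'e \<Rightarrow> 's \<Rightarrow> 's \<Rightarrow> real"
    and M :: "'w measure" and P :: "'e \<Rightarrow> 'w \<Rightarrow> 's \<Rightarrow> real"
    and N :: "'u measure" and Q :: "'u \<Rightarrow> 's \<Rightarrow> real"
  assumes "rooted_tree T \<rho>"
    and "m \<ge> 1" and "leaves T \<subseteq> level T \<rho> m"
    and "mrf T D \<Psi>"
    and "prob_space M"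
    and "prob_space.indep_vars M (\<lambda>e. vec_borel (D (head T e))) P (out_arcs T \<rho>)"
    and "\<And>e. e \<in> out_arcs T \<rho> \<Longrightarrow>
           distr M (vec_borel (D (head T e))) (P e)
             = residual_dist (subtree T (head T e)) (head T e) D \<Psi> (m - 1)"
    and "prob_space N"
    and "Q \<in> measurable N (vec_borel (D \<rho>))"
    and "distr N (vec_borel (D \<rho>)) Q = residual_dist T \<rho> D \<Psi> m"
  shows "\<exists>c>0. \<forall>\<eta>\<in>prob_vectors (D \<rho>).
           \<P>(\<omega> in N. Q \<omega> = \<eta>)
             = c * (\<integral>\<omega>. total_mass (D \<rho>) (bp_map T \<rho> D \<Psi> (\<lambda>e. P e \<omega>))
                       * of_bool (proportional_on (D \<rho>) (bp_map T \<rho> D \<Psi> (\<lambda>e. P e \<omega>)) \<eta>) \<partial>M)"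
proof -
  interpret rooted_tree_mrf T \<rho> D \<Psi>
    using assms(1,4) by (rule rooted_tree_mrf.intro)
  interpret M: prob_space M by fact
  \<comment> \<open>The boundary of \<open>T\<close> at depth \<open>Suc k\<close> lies at depth
    \<open>k = m - 1\<close> in the subtrees.\<close>
  obtain k where m: "m = Suc k" using assms(2) by (cases m) auto
  let ?I = "out_arcs T \<rho>" and ?lev = "\<lambda>e. level (child e) (head T e) k"
  define c where "c = (\<Prod>e\<in>?I. partition_fun (child e) D \<Psi>) / partition_fun T D \<Psi>"
  have "c > 0"
    unfolding c_def using mrf.partition_fun_pos[OF mrf_child] partition_fun_pos
    by (intro divide_pos_pos prod_pos) auto
  moreover have "\<P>(\<omega> in N. Q \<omega> = \<eta>)
      = c * (\<integral>\<omega>. total_mass (D \<rho>) (bp_map T \<rho> D \<Psi> (\<lambda>e. P e \<omega>))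
                * of_bool (proportional_on (D \<rho>) (bp_map T \<rho> D \<Psi> (\<lambda>e. P e \<omega>)) \<eta>) \<partial>M)"
    if \<eta>: "\<eta> \<in> prob_vectors (D \<rho>)" for \<eta>
  proof -
    define G where "G y = total_mass (D \<rho>) (bp_map T \<rho> D \<Psi> y)
      * of_bool (proportional_on (D \<rho>) (bp_map T \<rho> D \<Psi> y) \<eta>)" for y
    let ?B = "\<Pi>\<^sub>E v\<in>level T \<rho> m. D v" and ?B' = "\<lambda>e. \<Pi>\<^sub>E v\<in>?lev e. D v"
    let ?p = "\<lambda>e. boundary_pmf (child e) (head T e) D \<Psi> k"
    let ?post = "\<lambda>e. root_posterior (child e) (head T e) D \<Psi> k"
    have sing: "{\<eta>} \<in> sets (vec_borel (D \<rho>))"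
      using \<eta> finite_domain[OF root_in_verts]
      by (intro singleton_in_sets_vec_borel) (auto simp: prob_vectors_def PiE_iff)
    \<comment> \<open>Only arcs at the root enter \<open>bp_map\<close>; the restriction puts the
      family of vectors into the product space.\<close>
    have "(\<integral>\<omega>. G (\<lambda>e. P e \<omega>) \<partial>M) = (\<integral>\<omega>. G (\<lambda>e\<in>?I. P e \<omega>) \<partial>M)"
    proof -
      have "bp_map T \<rho> D \<Psi> (\<lambda>e. P e \<omega>) = bp_map T \<rho> D \<Psi> (\<lambda>e\<in>?I. P e \<omega>)" for \<omega>
        unfolding bp_map_def by (intro restrict_ext prod.cong) auto
      then show ?thesis by (simp add: G_def)
    qed
    also have "\<dots> = (\<Sum>y\<in>PiE ?I ?B'. (\<Prod>e\<in>?I. pmf (?p e) (y e)) * G (\<lambda>e\<in>?I. ?post e (y e)))"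
    proof (rule M.expectation_indep_vars_finite_support[OF finite_out_arcs_root assms(6)])
      show "distr M (vec_borel (D (head T e))) (P e)
          = distr (measure_pmf (?p e)) (vec_borel (D (head T e))) (?post e)" if "e \<in> ?I" for e
        using assms(7)[OF that] by (simp add: m residual_dist_eq)
      show "G \<in> borel_measurable (PiM ?I (\<lambda>e. vec_borel (D (head T e))))"
        unfolding G_def by (rule bp_map_integrand_measurable[OF \<eta>])
    qed (assumption | rule root_posterior_measurable
        mrf.finite_boundaries[OF mrf_child] mrf.set_boundary_pmf[OF mrf_child])+
    \<comment> \<open>Families of boundary conditions on the subtrees are glued to boundary
      conditions of \<open>T\<close>.\<close>
    also have "\<dots> = (\<Sum>L\<in>?B. (\<Prod>e\<in>?I. pmf (?p e) (restrict L (?lev e))) * G (child_posteriors k L))"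
      unfolding m level_Suc
      by (subst sum.reindex_bij_betw[OF bij_betw_restrict_PiE_Union[OF disjoint_child_levels], symmetric])
        (intro sum.cong refl arg_cong2[where f = "(*)"] prod.cong arg_cong[where f = G] restrict_ext, auto)
    finally have "c * (\<integral>\<omega>. G (\<lambda>e. P e \<omega>) \<partial>M)
        = (\<Sum>L\<in>?B. c * ((\<Prod>e\<in>?I. pmf (?p e) (restrict L (?lev e))) * G (child_posteriors k L)))"
      by (simp add: sum_distrib_left)
    also have "\<dots> = (\<Sum>L\<in>?B. pmf (boundary_pmf T \<rho> D \<Psi> m) L * of_bool (root_posterior T \<rho> D \<Psi> m L = \<eta>))"
      unfolding c_def G_def m by (intro sum.cong refl boundary_term[OF _ \<eta>, symmetric])
    \<comment> \<open>The sum is now the probability that a random boundary condition has posterior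
      \<open>\<eta>\<close>, which the law of \<open>Q\<close> carries over to
      \<open>N\<close>.\<close>
    also have "\<dots> = measure_pmf.expectation (boundary_pmf T \<rho> D \<Psi> m)
        (indicator {L. root_posterior T \<rho> D \<Psi> m L = \<eta>})"
      using set_boundary_pmf[of \<rho> m]
      by (subst integral_measure_pmf[OF finite_boundaries]) (auto simp: indicator_def)
    also have "\<dots> = measure (distr (measure_pmf (boundary_pmf T \<rho> D \<Psi> m)) (vec_borel (D \<rho>))
        (root_posterior T \<rho> D \<Psi> m)) {\<eta>}"
      using sing measurable_space[OF root_posterior_measurable]
      by (subst measure_distr) (auto simp: vimage_def)
    also have "\<dots> = measure N (Q -` {\<eta>} \<inter> space N)"
      unfolding residual_dist_eq[symmetric] assms(10)[symmetric]
      using assms(9) sing by (rule measure_distr)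
    also have "Q -` {\<eta>} \<inter> space N = {\<omega> \<in> space N. Q \<omega> = \<eta>}" by auto
    finally show ?thesis by (simp add: G_def)
  qed
  ultimately show ?thesis by blast
qed

end
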